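(* For all $m>n$, there is an $\mathrm{R}^0(\mathrm{lin})$ refutation of $\neg\mathrm{PHP}^m_n$ of size polynomial in $n$.
   Context: Linear equations $\vec a\cdot\vec x=a_0$ have integer coefficients, size $\sum|a_i|$ (unary). Disjunctions of linear equations: satisfied iff some equation holds; empty disjunction false; size = total size. Clause $\bigvee_{i\in I}x_i\vee\bigvee_{j\in J}\neg x_j$ translates to $\bigvee_{i\in I}(x_i=1)\vee\bigvee_{j\in J}(x_j=0)$. R(lin) proofs: sequences of disjunctions, each initial, a Boolean axiom $(x_h=0)\vee(x_h=1)$, or derived by Resolution (from $A\vee L_1$, $B\vee L_2$ derive $A\vee B\vee(L_1\pm L_2)$), Weakening (from $A$ derive $A\vee L$), Simplification (from $A\vee(0=k)$, $k\ne0$, derive $A$); refutation = proof of the empty disjunction. An $\mathrm{R}^0(\mathrm{lin})$-line is a disjunction of linear equations whose variable coefficients are integers bounded by a fixed constant (free terms unbounded), partitionable into a constant number of sub-disjunctions each consisting of equations differing only in free terms or being a translated clause; $\mathrm{R}^0(\mathrm{lin})$ = R(lin) with only such lines. $\neg\mathrm{PHP}^m_n$ has variables $x_{i,j}$ ($i\in[m]$, $j\in[n]$) and consists of: pigeon axioms $(x_{i,1}=1)\vee\dots\vee(x_{i,n}=1)$ for all $i\in[m]$; hole axioms $(x_{i,k}=0)\vee(x_{j,k}=0)$ for all $1\le i<j\le m$, $k\in[n]$. *)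

theory Defs
  imports Main "HOL-Library.Poly_Mapping" "HOL-Library.Product_Plus" "HOL-Library.Disjoint_Sets"
    "HOL-Computational_Algebra.Polynomial"
begin

text \<open>The pair \<open>(a, a0)\<close> stands for the linear equation \<open>a \<cdot> x = a0\<close>; \<open>+\<close> and \<open>-\<close> on equations
  are componentwise. A disjunction is the finite set of its equations, so duplicate equations are
  discarded, and the empty set is the empty (false) disjunction.\<close>

type_synonym 'v lineq = "('v \<Rightarrow>\<^sub>0 int) \<times> int"
type_synonym 'v lindisj = "'v lineq set"

definition coeff_of :: "'v lineq \<Rightarrow> 'v \<Rightarrow> int" where
  "coeff_of E v = Poly_Mapping.lookup (fst E) v"

definition eq_vars :: "'v lineq \<Rightarrow> 'v set" where
  "eq_vars E = Poly_Mapping.keys (fst E)"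

definition var_eq :: "'v \<Rightarrow> int \<Rightarrow> 'v lineq" where
  "var_eq v b = (Poly_Mapping.single v 1, b)"

definition eq_size :: "'v lineq \<Rightarrow> nat" where
  "eq_size E = (\<Sum>v\<in>eq_vars E. nat \<bar>coeff_of E v\<bar>) + nat \<bar>snd E\<bar>"

definition disj_size :: "'v lindisj \<Rightarrow> nat" where
  "disj_size D = (\<Sum>E\<in>D. eq_size E)"

definition lindisj_over :: "'v set \<Rightarrow> 'v lindisj \<Rightarrow> bool" where
  "lindisj_over V D \<longleftrightarrow> finite D \<and> (\<forall>E\<in>D. eq_vars E \<subseteq> V)"

definition clause_disj :: "'v set \<Rightarrow> 'v set \<Rightarrow> 'v lindisj" where
  "clause_disj I J = (\<lambda>i. var_eq i 1) ` I \<union> (\<lambda>j. var_eq j 0) ` J"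

text \<open>\<open>K\<close> is the set of initial disjunctions and \<open>S\<close> the set of preceding proof lines.\<close>

inductive rlin_step :: "'v lindisj set \<Rightarrow> 'v lindisj set \<Rightarrow> 'v lindisj \<Rightarrow> bool"
  for K S :: "'v lindisj set" where
  initial: "D \<in> K \<Longrightarrow> rlin_step K S D"
| boolean_axiom: "rlin_step K S {var_eq h 0, var_eq h 1}"
| resolution_add: "insert L1 A \<in> S \<Longrightarrow> insert L2 B \<in> S \<Longrightarrow> rlin_step K S (A \<union> B \<union> {L1 + L2})"
| resolution_diff: "insert L1 A \<in> S \<Longrightarrow> insert L2 B \<in> S \<Longrightarrow> rlin_step K S (A \<union> B \<union> {L1 - L2})"
| weakening: "A \<in> S \<Longrightarrow> rlin_step K S (insert L A)"
| simplification: "insert (0, k) A \<in> S \<Longrightarrow> k \<noteq> 0 \<Longrightarrow> rlin_step K S A"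

definition rlin_proof :: "'v set \<Rightarrow> 'v lindisj set \<Rightarrow> 'v lindisj list \<Rightarrow> bool" where
  "rlin_proof V K \<pi> \<longleftrightarrow>
     (\<forall>i<length \<pi>. lindisj_over V (\<pi> ! i) \<and> rlin_step K (set (take i \<pi>)) (\<pi> ! i))"

definition rlin_refutation :: "'v set \<Rightarrow> 'v lindisj set \<Rightarrow> 'v lindisj list \<Rightarrow> bool" where
  "rlin_refutation V K \<pi> \<longleftrightarrow> rlin_proof V K \<pi> \<and> \<pi> \<noteq> [] \<and> last \<pi> = {}"

definition proof_size :: "'v lindisj list \<Rightarrow> nat" where
  "proof_size \<pi> = (\<Sum>D\<leftarrow>\<pi>. disj_size D)"

text \<open>\<open>c\<close> bounds the coefficients of the variables (not the free terms) and \<open>d\<close> bounds the number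
  of sub-disjunctions.\<close>

definition R0lin_line :: "nat \<Rightarrow> nat \<Rightarrow> 'v lindisj \<Rightarrow> bool" where
  "R0lin_line c d D \<longleftrightarrow>
     (\<forall>E\<in>D. \<forall>v. \<bar>coeff_of E v\<bar> \<le> int c) \<and>
     (\<exists>P. partition_on D P \<and> finite P \<and> card P \<le> d \<and>
        (\<forall>B\<in>P. (\<exists>a. \<forall>E\<in>B. fst E = a) \<or> (\<exists>I J. B = clause_disj I J)))"

definition R0lin_refutation ::
    "nat \<Rightarrow> nat \<Rightarrow> 'v set \<Rightarrow> 'v lindisj set \<Rightarrow> 'v lindisj list \<Rightarrow> bool" where
  "R0lin_refutation c d V K \<pi> \<longleftrightarrow> rlin_refutation V K \<pi> \<and> (\<forall>D\<in>set \<pi>. R0lin_line c d D)"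

definition php_vars :: "nat \<Rightarrow> nat \<Rightarrow> (nat \<times> nat) set" where
  "php_vars m n = {1..m} \<times> {1..n}"

definition neg_PHP :: "nat \<Rightarrow> nat \<Rightarrow> (nat \<times> nat) lindisj set" where
  "neg_PHP m n =
     {{var_eq (i, j) 1 | j. j \<in> {1..n}} | i. i \<in> {1..m}} \<union>
     {{var_eq (i, k) 0, var_eq (j, k) 0} | i j k. 1 \<le> i \<and> i < j \<and> j \<le> m \<and> k \<in> {1..n}}"

end

theory Submission imports Defs begin

text \<open>Only the first \<open>N = n + 1\<close> pigeons are used, so the size does not depend on \<open>m\<close>. The hole axioms
  of a hole \<open>k\<close> yield that the column sum of the \<open>x\<^sub>i\<^sub>k\<close> is 0 or 1, and the axiom of a pigeon \<open>i\<close>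
  yields that the row sum of the \<open>x\<^sub>i\<^sub>j\<close> is one of \<open>1, \<dots>, n\<close>. Adding up the columns puts the sum of
  all variables in \<open>{0..n}\<close>, adding up the rows puts it in \<open>{N..N * n}\<close>, and subtracting these two
  disjunctions leaves only equations \<open>0 = k\<close> with \<open>k \<noteq> 0\<close>.\<close>

section \<open>Line-counted derivations\<close>

text \<open>\<open>S\<close> holds the lines written so far, and \<open>n\<close> only bounds the
  number of further ones, as \<open>base\<close> leaves it free. With \<open>Q\<close> abstract,
  line format and size can be checked once, on the finished proof.\<close>

inductive derives ::
    "'v lindisj set \<Rightarrow> ('v lindisj \<Rightarrow> bool) \<Rightarrow> 'v lindisj set \<Rightarrow> nat \<Rightarrow> 'v lindisj \<Rightarrow> bool"
  for K Q where
  base: "D \<in> S \<Longrightarrow> derives K Q S n D"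
| step: "rlin_step K S D \<Longrightarrow> Q D \<Longrightarrow> derives K Q (insert D S) n E \<Longrightarrow> derives K Q S (Suc n) E"

lemma rlin_step_mono: "rlin_step K S D \<Longrightarrow> S \<subseteq> T \<Longrightarrow> rlin_step K T D"
  by (induction rule: rlin_step.induct) (blast intro: rlin_step.intros)+

lemma derives_mono_lines: "derives K Q S n D \<Longrightarrow> S \<subseteq> T \<Longrightarrow> derives K Q T n D"
proof (induction arbitrary: T rule: derives.induct)
  case (base D S n)
  then show ?case by (auto intro: derives.base)
next
  case (step S D n E)
  have "insert D S \<subseteq> insert D T" using step.prems by auto
  then show ?case
    using step.IH step.hyps step.prems by (blast intro: derives.step rlin_step_mono)
qed

lemma derives_mono_length: "derives K Q S n D \<Longrightarrow> n \<le> m \<Longrightarrow> derives K Q S m D"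
proof (induction arbitrary: m rule: derives.induct)
  case (base D S n)
  then show ?case by (auto intro: derives.base)
next
  case (step S D n E)
  then show ?case by (cases m) (auto intro: derives.step)
qed

text \<open>The lines of the second derivation are appended to those of the first, so
  \<open>D\<close> is paid for once, however often it is used later.\<close>

lemma derives_cut:
  "derives K Q S m D \<Longrightarrow> derives K Q (insert D S) n E \<Longrightarrow> derives K Q S (m + n) E"
proof (induction rule: derives.induct)
  case (base D S m)
  then show ?case by (auto simp: insert_absorb intro: derives_mono_length)
next
  case (step S D' m D)
  have "derives K Q (insert D (insert D' S)) n E"
    using step.prems by (rule derives_mono_lines) auto
  then show ?case using step by (auto intro: derives.step)
qed

lemma derives_single: "rlin_step K S D \<Longrightarrow> Q D \<Longrightarrow> 0 < n \<Longrightarrow> derives K Q S n D"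
  by (cases n) (auto intro: derives.intros)

lemma derives_proof:
  assumes "derives K Q S n E" and "rlin_proof V K \<pi>" and "set \<pi> = S" and "\<forall>D\<in>S. Q D"
    and over: "\<And>D. Q D \<Longrightarrow> lindisj_over V D"
  shows "\<exists>\<rho>. rlin_proof V K \<rho> \<and> E \<in> set \<rho> \<and> (\<forall>D\<in>set \<rho>. Q D) \<and> length \<rho> \<le> length \<pi> + n"
  using assms(1-4)
proof (induction arbitrary: \<pi> rule: derives.induct)
  case (base D S n)
  then show ?case by (intro exI[of _ \<pi>]) auto
next
  case (step S D n E)
  have "rlin_proof V K (\<pi> @ [D])"
    using step.prems step.hyps over[OF step.hyps(2)]
    by (auto simp: rlin_proof_def nth_append less_Suc_eq)
  from step.IH[OF this] show ?case using step.prems step.hyps by auto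
qed

lemma derives_refutation:
  assumes "derives K Q {} n {}" and over: "\<And>D. Q D \<Longrightarrow> lindisj_over V D"
  shows "\<exists>\<rho>. rlin_refutation V K \<rho> \<and> (\<forall>D\<in>set \<rho>. Q D) \<and> length \<rho> \<le> n"
proof -
  obtain \<rho> where \<rho>: "rlin_proof V K \<rho>" "{} \<in> set \<rho>" "\<forall>D\<in>set \<rho>. Q D" "length \<rho> \<le> n"
    using derives_proof[OF assms(1), of V "[]"] over by (auto simp: rlin_proof_def)
  then obtain i where i: "i < length \<rho>" "\<rho> ! i = {}" by (auto simp: in_set_conv_nth)
  \<comment> \<open>The empty disjunction may occur in the middle of the proof, while a refutation
    has to end with it; a prefix of a proof is again a proof.\<close>
  have "rlin_refutation V K (take (Suc i) \<rho>)"
    using \<rho>(1) i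
    by (simp add: rlin_refutation_def rlin_proof_def take_Suc_conv_app_nth nth_append less_Suc_eq)
       metis
  moreover have "\<forall>D\<in>set (take (Suc i) \<rho>). Q D" using \<rho>(3) by (meson in_set_takeD)
  ultimately show ?thesis using \<rho>(4) by (intro exI[of _ "take (Suc i) \<rho>"]) auto
qed

section \<open>Resolving whole blocks of equations\<close>

text \<open>The line with \<open>L\<close> is reused to resolve away the elements of
  \<open>B\<close> one at a time, each \<open>M\<close> being replaced by \<open>h M\<close>. All
  new lines are subsets of \<open>\<Omega>\<close>, which yields \<open>Q\<close>. \<open>B\<close>
  is nonempty because only a resolution step brings \<open>\<Gamma>\<close> into the line.\<close>

lemma derives_resolve_block:
  assumes Q: "\<And>D. D \<subseteq> \<Omega> \<Longrightarrow> Q D"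
    and "finite B" "B \<noteq> {}" and "insert L \<Gamma> \<in> S" "\<Theta> \<union> B \<in> S"
    and "\<And>M. M \<in> B \<Longrightarrow> h M \<in> {L + M, L - M}"
    and "\<Gamma> \<union> \<Theta> \<union> B \<union> h ` B \<subseteq> \<Omega>"
  shows "derives K Q S (card B) (\<Gamma> \<union> \<Theta> \<union> h ` B)"
proof -
  have res: "derives K Q S n E" 
    if "insert L \<Gamma> \<in> S" "insert M C \<in> S" "h M \<in> {L + M, L - M}"
      "\<Gamma> \<union> C \<union> {h M} \<subseteq> \<Omega>" "derives K Q (insert (\<Gamma> \<union> C \<union> {h M}) S) k E" "n = Suc k"
    for M C S n k E
  proof -
    have "rlin_step K S (\<Gamma> \<union> C \<union> {h M})"
      using that(3) rlin_step.resolution_add[OF that(1,2), of K]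
        rlin_step.resolution_diff[OF that(1,2), of K] by auto
    then show ?thesis using that Q by (metis derives.step)
  qed
  show ?thesis using assms(2-7)
  proof (induction arbitrary: \<Theta> S rule: finite_ne_induct)
    case (singleton M)
    show ?case
      by (rule res[where M = M and C = \<Theta> and k = 0]) (use singleton in \<open>auto intro: derives.base\<close>)
  next
    case (insert M B)
    let ?\<Theta> = "insert (h M) (\<Gamma> \<union> \<Theta>)"
    have "derives K Q (insert (?\<Theta> \<union> B) S) (card B) (\<Gamma> \<union> ?\<Theta> \<union> h ` B)"
      by (rule insert.IH) (use insert.prems in auto)
    moreover have "?\<Theta> \<union> B = \<Gamma> \<union> (\<Theta> \<union> B) \<union> {h M}"
      "\<Gamma> \<union> ?\<Theta> \<union> h ` B = \<Gamma> \<union> \<Theta> \<union> h ` (insert M B)"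
      by auto
    ultimately have rest: "derives K Q (insert (\<Gamma> \<union> (\<Theta> \<union> B) \<union> {h M}) S) (card B)
        (\<Gamma> \<union> \<Theta> \<union> h ` (insert M B))"
      by simp
    show ?case
      by (rule res[where M = M and C = "\<Theta> \<union> B" and k = "card B"]) (use insert rest in auto)
  qed
qed

text \<open>The side formulas \<open>\<Delta>\<close> have to occur in \<open>\<Gamma>\<close> because for empty \<open>A\<close> no resolution step takes
  place.\<close>

lemma derives_combine_blocks:
  assumes Q: "\<And>D. D \<subseteq> \<Omega> \<Longrightarrow> Q D"
    and B: "finite B" "B \<noteq> {}" and "finite A" "\<Gamma> \<union> A \<in> S" "\<Delta> \<union> B \<in> S" "\<Delta> \<subseteq> \<Gamma>"
    and g: "\<And>L M. L \<in> A \<Longrightarrow> M \<in> B \<Longrightarrow> g L M \<in> {L + M, L - M}"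
    and "\<Gamma> \<union> A \<union> B \<union> (\<Union>L\<in>A. g L ` B) \<subseteq> \<Omega>"
  shows "derives K Q S (card A * card B) (\<Gamma> \<union> (\<Union>L\<in>A. g L ` B))"
  using assms(4-)
proof (induction arbitrary: \<Gamma> S rule: finite_induct)
  case empty
  then show ?case by (auto intro: derives.base)
next
  case (insert L A)
  \<comment> \<open>The results obtained from \<open>L\<close> join the side formula, and the line
    with \<open>B\<close> stays available for the rest of \<open>A\<close>.\<close>
  let ?\<Gamma> = "\<Gamma> \<union> g L ` B"
  have "derives K Q S (card B) ((\<Gamma> \<union> A) \<union> \<Delta> \<union> g L ` B)"
    by (rule derives_resolve_block[OF Q B, where L = L]) (use insert.prems in auto)
  moreover have eq: "(\<Gamma> \<union> A) \<union> \<Delta> \<union> g L ` B = ?\<Gamma> \<union> A" using insert.prems by auto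
  moreover have "derives K Q (insert (?\<Gamma> \<union> A) S) (card A * card B) (?\<Gamma> \<union> (\<Union>L\<in>A. g L ` B))"
    by (rule insert.IH) (use insert.prems in auto)
  ultimately have "derives K Q S (card B + card A * card B) (?\<Gamma> \<union> (\<Union>L\<in>A. g L ` B))"
    using derives_cut by metis
  then show ?case using insert.hyps by (simp add: Un_assoc)
qed

lemma derives_simplify_block:
  assumes Q: "\<And>D. D \<subseteq> \<Omega> \<Longrightarrow> Q D"
    and "finite C" and "\<Theta> \<union> C \<in> S" "\<Theta> \<union> C \<subseteq> \<Omega>"
    and "\<And>E. E \<in> C \<Longrightarrow> fst E = 0 \<and> snd E \<noteq> 0"
  shows "derives K Q S (card C) \<Theta>"
  using assms(2-)
proof (induction arbitrary: S rule: finite_induct)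
  case empty
  then show ?case by (auto intro: derives.base)
next
  case (insert E C)
  have "E = (0, snd E)" using insert.prems by (simp add: prod_eq_iff)
  then have "insert (0, snd E) (\<Theta> \<union> C) \<in> S" using insert.prems by simp
  then have "rlin_step K S (\<Theta> \<union> C)"
    by (rule rlin_step.simplification) (use insert.prems in auto)
  moreover have "derives K Q (insert (\<Theta> \<union> C) S) (card C) \<Theta>"
    by (rule insert.IH) (use insert.prems in auto)
  ultimately show ?case using insert Q by (auto intro: derives.step)
qed

section \<open>Disjunctions over the values of a sum of variables\<close>

definition vsum :: "'v set \<Rightarrow> 'v \<Rightarrow>\<^sub>0 int" where
  "vsum U = (\<Sum>v\<in>U. Poly_Mapping.single v 1)"

text \<open>All its equations differ only in the free term, so it forms a single block of an R0(lin)
  line. For \<open>U = {}\<close> the equations read \<open>0 = k\<close>.\<close>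

definition sum_in :: "'v set \<Rightarrow> int set \<Rightarrow> 'v lindisj" where
  "sum_in U A = {vsum U} \<times> A"

lemma vsum_simps [simp]: "vsum {} = 0" "vsum {v} = Poly_Mapping.single v 1"
  by (simp_all add: vsum_def)

lemma vsum_union: "finite U \<Longrightarrow> finite W \<Longrightarrow> U \<inter> W = {} \<Longrightarrow> vsum (U \<union> W) = vsum U + vsum W"
  by (simp add: vsum_def sum.union_disjoint)

lemma lookup_vsum: "finite U \<Longrightarrow> Poly_Mapping.lookup (vsum U) v = (if v \<in> U then 1 else 0)"
  by (simp add: vsum_def lookup_sum lookup_single when_def)

lemma keys_vsum: "finite U \<Longrightarrow> Poly_Mapping.keys (vsum U) = U"
  by (auto simp: in_keys_iff lookup_vsum split: if_splits)

lemma sum_in_mono: "A \<subseteq> B \<Longrightarrow> sum_in U A \<subseteq> sum_in U B"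
  by (auto simp: sum_in_def)

lemma sum_in_single: "sum_in {v} {k} = {var_eq v k}"
  by (simp add: sum_in_def var_eq_def)

lemma interval_sumset:
  fixes a b c d :: int
  assumes "a \<le> b" "c \<le> d"
  shows "(\<Union>k\<in>{a..b}. (+) k ` {c..d}) = {a + c..b + d}"
proof (intro equalityI subsetI)
  fix x assume x: "x \<in> {a + c..b + d}"
  \<comment> \<open>The least \<open>k \<ge> a\<close> for which the rest \<open>x - k\<close> does
    not exceed \<open>d\<close>.\<close>
  define k where "k = max a (x - d)"
  have "k \<in> {a..b}" "x - k \<in> {c..d}" using x assms by (auto simp: k_def)
  then show "x \<in> (\<Union>k\<in>{a..b}. (+) k ` {c..d})" by (force intro: image_eqI[of _ _ "x - k"])
qed auto

lemma sum_in_add: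
  fixes a b c d :: int
  assumes "finite U" "finite W" "U \<inter> W = {}" "a \<le> b" "c \<le> d"
  shows "(\<Union>L\<in>sum_in U {a..b}. (+) L ` sum_in W {c..d}) = sum_in (U \<union> W) {a + c..b + d}"
proof -
  have "(\<Union>L\<in>sum_in U X. (+) L ` sum_in W Y) = {vsum U + vsum W} \<times> (\<Union>k\<in>X. (+) k ` Y)" for X Y
    by (force simp: sum_in_def)
  then show ?thesis
    by (simp only: interval_sumset[OF assms(4,5)]) (simp add: sum_in_def vsum_union[OF assms(1-3)])
qed

section \<open>Admissible lines\<close>

text \<open>The common shape of all lines used. It is closed under subsets, as the set
  \<open>\<Omega>\<close> of the block lemmas requires. Four sums suffice for one addition: two
  operands, the result, and one in the side formula. Negative values arise in the final
  subtraction.\<close>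

definition admissible :: "'v set \<Rightarrow> nat \<Rightarrow> 'v lindisj \<Rightarrow> bool" where
  "admissible V M D \<longleftrightarrow> (\<exists>\<U>. \<U> \<subseteq> Pow V \<and> finite \<U> \<and> card \<U> \<le> 4 \<and>
     D \<subseteq> clause_disj V V \<union> (\<Union>U\<in>\<U>. sum_in U {- int M..int M}))"

lemma admissible_subset: "admissible V M E \<Longrightarrow> D \<subseteq> E \<Longrightarrow> admissible V M D"
  unfolding admissible_def by (meson subset_trans)

lemma subset_clause_disj:
  assumes "B \<subseteq> clause_disj I J"
  shows "\<exists>I' J'. B = clause_disj I' J'"
  by (rule exI[of _ "{i\<in>I. var_eq i 1 \<in> B}"], rule exI[of _ "{j\<in>J. var_eq j 0 \<in> B}"])
     (use assms in \<open>auto simp: clause_disj_def\<close>)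

text \<open>The literals form one clause block and every sum contributes at most one block, which
  makes at most five; the coefficients of a sum are 0 or 1.\<close>

lemma admissible_R0lin_line:
  assumes V: "finite V" and adm: "admissible V M D"
  shows "R0lin_line 1 5 D"
proof -
  obtain \<U> where \<U>: "\<U> \<subseteq> Pow V" "finite \<U>" "card \<U> \<le> 4"
    "D \<subseteq> clause_disj V V \<union> (\<Union>U\<in>\<U>. sum_in U {- int M..int M})"
    using adm by (auto simp: admissible_def)
  have coeffs: "\<bar>coeff_of E v\<bar> \<le> int 1" if "E \<in> D" for E v
  proof -
    have "E \<in> clause_disj V V \<or> (\<exists>U\<in>\<U>. fst E = vsum U)" using that \<U>(4) by (fastforce simp: sum_in_def)
    then show ?thesis
    proof
      assume "E \<in> clause_disj V V"
      then show ?thesis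
        by (auto simp: clause_disj_def coeff_of_def var_eq_def lookup_single when_def)
    next
      assume "\<exists>U\<in>\<U>. fst E = vsum U"
      then show ?thesis using \<U>(1) V by (auto simp: coeff_of_def lookup_vsum finite_subset)
    qed
  qed
  \<comment> \<open>For a one-element \<open>U\<close> an equation of \<open>sum_in\<close> can also
    be a literal. Removing the literals and indexing by the linear form keeps the blocks
    disjoint.\<close>
  define block where "block a = {E \<in> D - clause_disj V V. fst E = a}" for a
  define P where "P = insert (D \<inter> clause_disj V V) (block ` vsum ` \<U>) - {{}}"
  have "partition_on D P"
  proof (rule partition_onI)
    have "E \<in> D \<inter> clause_disj V V \<or> (\<exists>U\<in>\<U>. E \<in> block (vsum U))" if "E \<in> D" for E
      using that \<U>(4) by (fastforce simp: block_def sum_in_def)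
    moreover have "\<Union> (X - {{}}) = \<Union> X" for X :: "'a lindisj set" by auto
    then have "\<Union> P = (D \<inter> clause_disj V V) \<union> (\<Union>U\<in>\<U>. block (vsum U))"
      by (simp add: P_def)
    moreover have "block a \<subseteq> D" for a by (auto simp: block_def)
    ultimately show "\<Union> P = D" by blast
  next
    fix p q assume "p \<in> P" "q \<in> P" "p \<noteq> q"
    then show "disjnt p q" unfolding P_def disjnt_def by (auto simp: block_def)
  next
    show "{} \<notin> P" by (simp add: P_def)
  qed
  moreover have "finite P" using \<U>(2) by (auto simp: P_def)
  moreover have "card P \<le> 5"
  proof -
    have "card P \<le> card (insert (D \<inter> clause_disj V V) (block ` vsum ` \<U>))"
      unfolding P_def using \<U>(2) by (intro card_mono) auto
    also have "\<dots> \<le> Suc (card (block ` vsum ` \<U>))" using \<U>(2) by (simp add: card_insert_if)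
    also have "card (block ` vsum ` \<U>) \<le> card \<U>"
      by (metis \<U>(2) card_image_le finite_imageI le_trans)
    finally show ?thesis using \<U>(3) by simp
  qed
  moreover have "(\<exists>a. \<forall>E\<in>B. fst E = a) \<or> (\<exists>I J. B = clause_disj I J)" if "B \<in> P" for B
    using that subset_clause_disj[of "D \<inter> clause_disj V V" V V]
    by (auto simp: P_def block_def)
  ultimately show ?thesis unfolding R0lin_line_def using coeffs by blast
qed

lemma clause_disj_as_image: "clause_disj V V = (\<lambda>(v, b). var_eq v b) ` (V \<times> {0, 1})"
  by (auto simp: clause_disj_def)

text \<open>There are at most \<open>2 * s\<close> literals and \<open>4 * (2 * M + 1)\<close>
  equations from sums, hence at most \<open>10 * s\<close> equations. Each has size at most
  \<open>2 * s\<close>; for a sum this is at most \<open>card V\<close> for the coefficients plus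
  \<open>M\<close> for the free term.\<close>

lemma admissible_size:
  assumes V: "finite V" "card V \<le> s" and M: "M < s" and adm: "admissible V M D"
  shows "lindisj_over V D" "disj_size D \<le> 20 * s ^ 2"
proof -
  obtain \<U> where \<U>: "\<U> \<subseteq> Pow V" "finite \<U>" "card \<U> \<le> 4"
    "D \<subseteq> clause_disj V V \<union> (\<Union>U\<in>\<U>. sum_in U {- int M..int M})" (is "_ \<subseteq> ?R")
    using adm by (auto simp: admissible_def)
  have E: "eq_vars E \<subseteq> V \<and> eq_size E \<le> 2 * s" if "E \<in> D" for E
  proof -
    have "E \<in> clause_disj V V \<or> (\<exists>U\<in>\<U>. E \<in> sum_in U {- int M..int M})" using that \<U>(4) by auto
    then show ?thesis
    proof
      assume "E \<in> clause_disj V V"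
      then show ?thesis using M
        by (auto simp: clause_disj_def eq_vars_def eq_size_def coeff_of_def var_eq_def)
    next
      assume "\<exists>U\<in>\<U>. E \<in> sum_in U {- int M..int M}"
      then obtain U where mem: "U \<in> \<U>" "E \<in> sum_in U {- int M..int M}" by blast
      define k where "k = snd E"
      have U: "U \<subseteq> V" "E = (vsum U, k)" "\<bar>k\<bar> \<le> int M"
        using mem \<U>(1) by (auto simp: sum_in_def k_def)
      then have fin: "finite U" "card U \<le> card V" using V finite_subset card_mono by auto
      have "eq_size E = card U + nat \<bar>k\<bar>"
        using U fin by (simp add: eq_size_def eq_vars_def keys_vsum coeff_of_def lookup_vsum)
      then show ?thesis using U fin V M by (auto simp: eq_vars_def keys_vsum)
    qed
  qed
  have fin: "finite ?R" using V \<U>(2) by (auto simp: clause_disj_def sum_in_def)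
  have finD: "finite D" by (rule finite_subset[OF \<U>(4) fin])
  then show "lindisj_over V D" using E by (auto simp: lindisj_over_def)
  have "card D \<le> card ?R" by (rule card_mono[OF fin \<U>(4)])
  also have "\<dots> \<le> card (clause_disj V V) + card (\<Union>U\<in>\<U>. sum_in U {- int M..int M})"
    by (rule card_Un_le)
  also have "card (clause_disj V V) \<le> 2 * s"
  proof -
    have "card (clause_disj V V) \<le> card (V \<times> {0::int, 1})"
      unfolding clause_disj_as_image using V by (intro card_image_le) auto
    then show ?thesis using V(2) by (simp add: card_cartesian_product)
  qed
  also have "card (\<Union>U\<in>\<U>. sum_in U {- int M..int M}) \<le> (\<Sum>U\<in>\<U>. 2 * s)"
    using \<U>(2) M
    by (intro order_trans[OF card_UN_le[OF \<U>(2)]] sum_mono)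
       (simp add: sum_in_def card_cartesian_product)
  also have "\<dots> \<le> 8 * s" using \<U>(3) by simp
  finally have card: "card D \<le> 10 * s" by simp
  have "disj_size D \<le> (\<Sum>E\<in>D. 2 * s)" unfolding disj_size_def using E by (intro sum_mono) auto
  also have "\<dots> \<le> 20 * s ^ 2" using mult_right_mono[OF card, of "2 * s"]
    by (simp add: power2_eq_square)
  finally show "disj_size D \<le> 20 * s ^ 2" .
qed

lemma admissible_clause: "D \<subseteq> clause_disj V V \<Longrightarrow> admissible V M D"
  unfolding admissible_def by (rule exI[of _ "{}"]) auto

lemma admissible_three_sums:
  assumes "U \<subseteq> V" "W \<subseteq> V" "Z \<subseteq> V"
    and "D \<subseteq> clause_disj V V \<union> sum_in Z {- int M..int M} \<union> sum_in U {- int M..int M} \<union>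
      sum_in W {- int M..int M} \<union> sum_in (U \<union> W) {- int M..int M}"
  shows "admissible V M D"
proof -
  have "card {Z, U, W, U \<union> W} \<le> 4"
    by (rule card_insert_le_m1, simp)+ simp
  then show ?thesis
    unfolding admissible_def
    by (intro exI[of _ "{Z, U, W, U \<union> W}"] conjI) (use assms in auto)
qed

section \<open>Adding disjunctions\<close>

locale sum_system =
  fixes K :: "'v lindisj set" and V :: "'v set" and M :: nat
  assumes finite_V: "finite V"
begin

abbreviation derivable :: "nat \<Rightarrow> 'v lindisj \<Rightarrow> bool" where
  "derivable n D \<equiv> derives K (admissible V M) {} n D"

text \<open>Bounds the cost of combining two sums: each has at most \<open>2 * M + 1\<close> values,
  and every pair of values takes one resolution step.\<close>

definition w :: nat where
  "w = (2 * M + 1) ^ 2"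

lemma derivable_boolean:
  assumes "v \<in> V"
  shows "derivable 1 (sum_in {v} {0..1})"
proof -
  have "{0..1::int} = {0, 1}" by auto
  then have eq: "sum_in {v} {0..1} = {var_eq v 0, var_eq v 1}" by (simp add: sum_in_def var_eq_def)
  show ?thesis
    unfolding eq using assms
    by (intro derives_single rlin_step.boolean_axiom admissible_clause) (auto simp: clause_disj_def)
qed

text \<open>Admissibility is checked once, for the union of everything that can occur; the lines of
  the combination are subsets of it.\<close>

lemma derivable_combine:
  assumes m: "derivable m (\<Gamma> \<union> A)" and n: "derivable n (\<Delta> \<union> B)"
    and A: "A \<subseteq> sum_in U {- int M..int M}" and B: "B \<subseteq> sum_in W {- int M..int M}" "B \<noteq> {}"
    and "\<Delta> \<subseteq> \<Gamma>" and g: "\<And>L E. g L E \<in> {L + E, L - E}"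
    and adm: "admissible V M (\<Gamma> \<union> A \<union> B \<union> (\<Union>L\<in>A. g L ` B))"
  shows "derivable (m + n + w) (\<Gamma> \<union> (\<Union>L\<in>A. g L ` B))"
proof -
  have fin: "finite (sum_in X {- int M..int M})" "card (sum_in X {- int M..int M}) = 2 * M + 1"
    for X :: "'v set"
    by (simp_all add: sum_in_def card_cartesian_product)
  have finite: "finite A" "finite B" using A B fin finite_subset by blast+
  have "card A \<le> 2 * M + 1" "card B \<le> 2 * M + 1" using A B fin card_mono by metis+
  then have cards: "card A * card B \<le> w"
    unfolding w_def power2_eq_square by (rule mult_le_mono)
  have "derives K (admissible V M) {\<Gamma> \<union> A, \<Delta> \<union> B} (card A * card B) (\<Gamma> \<union> (\<Union>L\<in>A. g L ` B))"
    by (rule derives_combine_blocks[where \<Delta> = \<Delta> and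
          \<Omega> = "\<Gamma> \<union> A \<union> B \<union> (\<Union>L\<in>A. g L ` B)"])
       (use finite B assms(6) g adm in \<open>auto intro: admissible_subset\<close>)
  then have "derives K (admissible V M) (insert (\<Delta> \<union> B) {\<Gamma> \<union> A}) w (\<Gamma> \<union> (\<Union>L\<in>A. g L ` B))"
    using cards derives_mono_length by (simp add: insert_commute) blast
  moreover have "derives K (admissible V M) {\<Gamma> \<union> A} n (\<Delta> \<union> B)"
    using n by (rule derives_mono_lines) auto
  ultimately have "derives K (admissible V M) {\<Gamma> \<union> A} (n + w) (\<Gamma> \<union> (\<Union>L\<in>A. g L ` B))"
    by (rule derives_cut[rotated])
  then show ?thesis using derives_cut[OF m] by (simp add: add.assoc)
qed

text \<open>Disjointness of \<open>U\<close> and \<open>W\<close> keeps all coefficients 0 or 1. The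
  side formula may contain one more sum, over \<open>Z\<close>, which the row and column inductions
  need.\<close>

lemma derivable_add:
  fixes a b c d :: int
  assumes m: "derivable m (\<Gamma> \<union> sum_in U {a..b})" and n: "derivable n (\<Delta> \<union> sum_in W {c..d})"
    and UW: "U \<inter> W = {}" "U \<subseteq> V" "W \<subseteq> V"
    and \<Gamma>: "\<Delta> \<subseteq> \<Gamma>" "\<Gamma> \<subseteq> clause_disj V V \<union> sum_in Z {- int M..int M}" "Z \<subseteq> V"
    and bounds: "0 \<le> a" "a \<le> b" "0 \<le> c" "c \<le> d" "b + d \<le> int M"
  shows "derivable (m + n + w) (\<Gamma> \<union> sum_in (U \<union> W) {a + c..b + d})"
proof -
  have eq: "(\<Union>L\<in>sum_in U {a..b}. (+) L ` sum_in W {c..d}) = sum_in (U \<union> W) {a + c..b + d}"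
    using UW bounds finite_V by (intro sum_in_add) (auto intro: finite_subset)
  have subs: "sum_in U {a..b} \<subseteq> sum_in U {- int M..int M}"
    "sum_in W {c..d} \<subseteq> sum_in W {- int M..int M}"
    "sum_in (U \<union> W) {a + c..b + d} \<subseteq> sum_in (U \<union> W) {- int M..int M}"
    using bounds by (auto intro!: sum_in_mono)
  have "admissible V M (\<Gamma> \<union> sum_in U {a..b} \<union> sum_in W {c..d} \<union> sum_in (U \<union> W) {a + c..b + d})"
    by (rule admissible_three_sums[of U V W Z]) (use UW \<Gamma> subs in auto)
  then have "derivable (m + n + w) (\<Gamma> \<union> (\<Union>L\<in>sum_in U {a..b}. (+) L ` sum_in W {c..d}))"
    by (intro derivable_combine[OF m n subs(1,2)])
       (use bounds \<Gamma> in \<open>simp_all add: eq\<close>, simp add: sum_in_def)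
  then show ?thesis by (simp only: eq)
qed

text \<open>The members are added one after another. All carry the same \<open>\<Gamma>\<close>, so
  the side formula does not grow, and as \<open>hi\<close> is nonnegative the bound on
  \<open>t * hi\<close> also covers the partial sums.\<close>

lemma derivable_sum_family:
  fixes lo hi :: int
  assumes "1 \<le> t" and "\<And>s. s \<in> {1..t} \<Longrightarrow> derivable q (\<Gamma> \<union> sum_in (U s) {lo..hi})"
    and "disjoint_family_on U {1..t}" and "\<And>s. s \<in> {1..t} \<Longrightarrow> U s \<subseteq> V"
    and \<Gamma>: "\<Gamma> \<subseteq> clause_disj V V" and bounds: "0 \<le> lo" "lo \<le> hi" and "int t * hi \<le> int M"
  shows "derivable (t * (q + w)) (\<Gamma> \<union> sum_in (\<Union>s\<in>{1..t}. U s) {int t * lo..int t * hi})"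
  using assms(1-4,8)
proof (induction t rule: nat_induct_at_least)
  case base
  then show ?case using derives_mono_length[of K "admissible V M" "{}" q _ "q + w"] by simp
next
  case (Suc t)
  have "U s \<inter> U (Suc t) = {}" if "s \<in> {1..t}" for s
    using that by (intro disjoint_family_onD[OF Suc.prems(2)]) auto
  then have disj: "(\<Union>s\<in>{1..t}. U s) \<inter> U (Suc t) = {}" by blast
  have "(\<Union>s\<in>{1..t}. U s) \<subseteq> V"
    by (intro UN_least Suc.prems(3)) simp
  moreover have "U (Suc t) \<subseteq> V" by (rule Suc.prems(3)) simp
  ultimately have UV: "(\<Union>s\<in>{1..t}. U s) \<subseteq> V" "U (Suc t) \<subseteq> V" .
  have hi: "int t * hi + hi \<le> int M" "0 \<le> hi"
    using Suc.prems(4) bounds by (simp_all add: algebra_simps)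
  then have "int t * hi \<le> int M" by linarith
  then have IH: "derivable (t * (q + w)) (\<Gamma> \<union> sum_in (\<Union>s\<in>{1..t}. U s) {int t * lo..int t * hi})"
    using Suc.prems by (intro Suc.IH) (auto simp: disjoint_family_on_def)
  have "derivable (t * (q + w) + q + w)
      (\<Gamma> \<union> sum_in ((\<Union>s\<in>{1..t}. U s) \<union> U (Suc t)) {int t * lo + lo..int t * hi + hi})"
    by (rule derivable_add[OF IH Suc.prems(1)[of "Suc t"], where Z = "{}"])
       (use disj UV \<Gamma> bounds hi in \<open>auto simp: mult_left_mono\<close>)
  moreover have "(\<Union>s\<in>{1..t}. U s) \<union> U (Suc t) = (\<Union>s\<in>{1..Suc t}. U s)"
    by (auto simp: atLeastAtMostSuc_conv)
  ultimately show ?case by (simp add: algebra_simps)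
qed

text \<open>Subtraction over the same variables cancels them all and leaves equations
  \<open>0 = k\<close> with \<open>k\<close> in \<open>{a - d..b - c}\<close>, negative because
  \<open>b < c\<close>. Simplification then removes these one at a time.\<close>

lemma derivable_contradiction:
  fixes a b c d :: int
  assumes m: "derivable m (sum_in V {a..b})" and n: "derivable n (sum_in V {c..d})"
    and bounds: "0 \<le> a" "a \<le> b" "b < c" "c \<le> d" "d \<le> int M"
  shows "derivable (m + n + 2 * w) {}"
proof -
  define C where "C = (\<Union>L\<in>sum_in V {a..b}. (-) L ` sum_in V {c..d})"
  have C: "C \<subseteq> sum_in {} {- int M..-1}" using bounds by (auto simp: C_def sum_in_def)
  have adm: "admissible V M ({} \<union> sum_in V {a..b} \<union> sum_in V {c..d} \<union> C)"
  \<comment> \<open>Both operands are sums over \<open>V\<close>; the slot of the side sum, with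
    \<open>Z = {}\<close>, holds the differences \<open>0 = k\<close>.\<close>
  proof (rule admissible_three_sums[of V V V "{}"])
    have "sum_in V {a..b} \<subseteq> sum_in V {- int M..int M}" "sum_in V {c..d} \<subseteq> sum_in V {- int M..int M}"
      "sum_in {} {- int M..-1} \<subseteq> sum_in {} {- int M..int M}"
      using bounds by (auto intro!: sum_in_mono)
    then show "{} \<union> sum_in V {a..b} \<union> sum_in V {c..d} \<union> C \<subseteq>
      clause_disj V V \<union> sum_in {} {- int M..int M} \<union> sum_in V {- int M..int M} \<union>
      sum_in V {- int M..int M} \<union> sum_in (V \<union> V) {- int M..int M}"
      using C by blast
  qed auto
  have "derivable (m + n + w) ({} \<union> C)"
    unfolding C_def
    by (rule derivable_combine[where \<Delta> = "{}" and U = V and W = V])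
       (use m n bounds adm in \<open>auto simp: C_def sum_in_def\<close>)
  moreover have "derives K (admissible V M) {{} \<union> C} w {}"
  proof -
    have fin: "finite (sum_in ({} :: 'v set) {- int M..-1})" by (simp add: sum_in_def)
    have "derives K (admissible V M) {{} \<union> C} (card C) {}"
      by (rule derives_simplify_block[where \<Omega> = C])
         (use C adm finite_subset[OF C fin] in \<open>auto intro: admissible_subset simp: sum_in_def\<close>)
    moreover have "card C \<le> w"
    proof -
      have "card C \<le> M" using card_mono[OF fin C] by (simp add: sum_in_def card_cartesian_product)
      then show ?thesis by (simp add: w_def power2_eq_square)
    qed
    ultimately show ?thesis by (rule derives_mono_length)
  qed
  ultimately have "derivable (m + n + w + w) {}" by (rule derives_cut)
  then show ?thesis by (simp add: mult_2 add.assoc)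
qed

end

section \<open>The pigeonhole principle\<close>

locale pigeonhole =
  fixes m n :: nat
  assumes n_pos: "1 \<le> n" and n_less_m: "n < m"
begin

definition N :: nat where "N = n + 1"

text \<open>The value bound \<open>N * n\<close> is the number of variables, hence the largest value
  of their sum on 0/1 assignments.\<close>

sublocale sum_system "neg_PHP m n" "php_vars N n" "N * n"
  by unfold_locales (simp add: php_vars_def)

lemma N_bounds: "1 \<le> N" "n < N" "n \<le> N * n" "N \<le> N * n"
  using n_pos by (simp_all add: N_def)

text \<open>Bounds one step of the row or column induction: an auxiliary sum built from at most
  \<open>N\<close> axioms, one Boolean axiom, and two further additions.\<close>

definition r :: nat where
  "r = N * (1 + w) + 1 + 2 * w"

section \<open>Row sums from the pigeon axioms\<close>

text \<open>Only Boolean axioms enter, so 0 is among the values; the row induction adds this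
  disjunction to the case where the next variable is 1.\<close>

lemma derivable_row_boolean:
  assumes "i \<in> {1..N}" "1 \<le> t" "t \<le> n"
  shows "derivable (t * (1 + w)) (sum_in ({i} \<times> {1..t}) {0..int t})"
proof -
  have "derivable (t * (1 + w)) ({} \<union> sum_in (\<Union>s\<in>{1..t}. {(i, s)}) {int t * 0..int t * 1})"
  proof (rule derivable_sum_family)
    show "derivable 1 ({} \<union> sum_in {(i, s)} {0..1})" if "s \<in> {1..t}" for s
      using derivable_boolean[of "(i, s)"] that assms by (simp add: php_vars_def)
    show "int t * 1 \<le> int (N * n)"
      using le_trans[OF assms(3) N_bounds(3)] by (simp del: of_nat_mult)
  qed (use assms in \<open>auto simp: disjoint_family_on_def php_vars_def\<close>)
  moreover have "(\<Union>s\<in>{1..t}. {(i, s)}) = {i} \<times> {1..t}" by auto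
  ultimately show ?thesis by simp
qed

text \<open>If \<open>x\<^sub>i\<^sub>j = 1\<close> for \<open>j = t + 1\<close>, any value in \<open>{0..t}\<close> of the prefix sum leads to a positive
  sum of length \<open>t + 1\<close>; otherwise the prefix sum is already positive.\<close>

lemma derivable_row_prefix:
  assumes i: "i \<in> {1..N}" and "1 \<le> t" "t \<le> n"
  shows "derivable (t * r)
    ((\<lambda>j. var_eq (i, j) 1) ` {Suc t..n} \<union> sum_in ({i} \<times> {1..t}) {1..int t})"
  using assms(2,3)
proof (induction t rule: nat_induct_at_least)
  case base
  \<comment> \<open>For \<open>t = 1\<close> the sum part is the literal with \<open>j = 1\<close>,
    so the line is the pigeon axiom itself.\<close>
  have "(\<lambda>j. var_eq (i, j) 1) ` {Suc 1..n} \<union> sum_in ({i} \<times> {1..1}) {1..int 1} =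
    (\<lambda>j. var_eq (i, j) 1) ` {1..n}"
  proof -
    have "{1..n} = insert 1 {Suc 1..n}" using n_pos by auto
    then show ?thesis by (simp add: sum_in_single)
  qed
  also have "\<dots> = {var_eq (i, j) 1 | j. j \<in> {1..n}}" by auto
  also have "derivable (1 * r) \<dots>"
  proof (rule derives_single)
    show "rlin_step (neg_PHP m n) {} {var_eq (i, j) 1 | j. j \<in> {1..n}}"
      using i n_less_m by (intro rlin_step.initial) (auto simp: neg_PHP_def N_def)
    show "admissible (php_vars N n) (N * n) {var_eq (i, j) 1 | j. j \<in> {1..n}}"
      using i by (intro admissible_clause) (auto simp: clause_disj_def php_vars_def)
  qed (simp add: r_def)
  finally show ?case .
next
  case (Suc t)
  define X where "X = (\<lambda>j. var_eq (i, j) (1::int)) ` {Suc (Suc t)..n}"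
  let ?S = "\<lambda>t. {i} \<times> {1..t}" and ?v = "(i, Suc t)"
  have v: "?v \<in> php_vars N n" and S: "?S t \<subseteq> php_vars N n" "?S (Suc t) \<subseteq> php_vars N n"
    and S_Suc: "?S t \<union> {?v} = ?S (Suc t)" "{?v} \<union> ?S t = ?S (Suc t)" "?S t \<inter> {?v} = {}"
    "{?v} \<inter> ?S t = {}"
    using i Suc.prems by (auto simp: php_vars_def)
  have X: "X \<subseteq> clause_disj (php_vars N n) (php_vars N n)"
    using i by (auto simp: X_def clause_disj_def php_vars_def)
  have tM: "int (Suc t) \<le> int (N * n)"
    using le_trans[OF Suc.prems N_bounds(3)] by (simp only: of_nat_le_iff)
  have sub: "sum_in (?S t) {1..int t} \<subseteq> sum_in (?S t) {- int (N * n)..int (N * n)}"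
    "sum_in (?S (Suc t)) {1..1 + int t} \<subseteq> sum_in (?S (Suc t)) {- int (N * n)..int (N * n)}"
    using tM by (auto intro!: sum_in_mono)
  \<comment> \<open>The literal with \<open>j = t + 1\<close> is read as a one-variable sum of value
    1, so that the prefix sum can be added to it.\<close>
  have "{Suc t..n} = insert (Suc t) {Suc (Suc t)..n}" using Suc.prems by auto
  then have eq: "(\<lambda>j. var_eq (i, j) 1) ` {Suc t..n} \<union> sum_in (?S t) {1..int t} =
    (X \<union> sum_in (?S t) {1..int t}) \<union> sum_in {?v} {1..1}"
    by (auto simp: X_def sum_in_single)
  have IH: "derivable (t * r) ((X \<union> sum_in (?S t) {1..int t}) \<union> sum_in {?v} {1..1})"
    unfolding eq[symmetric] using Suc.prems by (intro Suc.IH) simp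
  have "derivable (t * r + t * (1 + w) + w)
    ((X \<union> sum_in (?S t) {1..int t}) \<union> sum_in ({?v} \<union> ?S t) {1 + 0..1 + int t})"
    by (rule derivable_add[where \<Delta> = "{}" and Z = "?S t", OF IH])
       (use derivable_row_boolean[OF i] Suc.hyps Suc.prems v S S_Suc X sub tM in auto)
  \<comment> \<open>The roles change: the new sum of length \<open>t + 1\<close> moves to the side
    formula, and the old prefix sum becomes the next operand.\<close>
  then have step: "derivable (t * r + t * (1 + w) + w)
    ((X \<union> sum_in (?S (Suc t)) {1..1 + int t}) \<union> sum_in (?S t) {1..int t})"
    unfolding S_Suc by (simp add: Un_ac)
  have bool: "derivable 1 ({} \<union> sum_in {?v} {0..1})" using derivable_boolean[OF v] by simp
  have \<Gamma>: "X \<union> sum_in (?S (Suc t)) {1..1 + int t} \<subseteq> clause_disj (php_vars N n) (php_vars N n) \<union>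
      sum_in (?S (Suc t)) {- int (N * n)..int (N * n)}"
    using X sub by blast
  \<comment> \<open>The result has the same range \<open>{1..t + 1}\<close> as the sum in the side
    formula, and the two merge because disjunctions are sets.\<close>
  have "derivable (t * r + t * (1 + w) + w + 1 + w)
    ((X \<union> sum_in (?S (Suc t)) {1..1 + int t}) \<union> sum_in (?S t \<union> {?v}) {1 + 0..int t + 1})"
    by (rule derivable_add[OF step bool S_Suc(3) S(1) _ _ \<Gamma> S(2)])
       (use v Suc.hyps tM in auto)
  then have "derivable (t * r + t * (1 + w) + w + 1 + w)
    (X \<union> sum_in (?S (Suc t)) {1..int (Suc t)})"
    unfolding S_Suc by (simp add: Un_assoc add.commute)
  moreover have "t * r + t * (1 + w) + w + 1 + w \<le> Suc t * r"
  proof -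
    have "t * (1 + w) \<le> N * (1 + w)" using Suc.prems by (intro mult_le_mono1) (simp add: N_def)
    then show ?thesis by (simp add: r_def)
  qed
  ultimately show ?case unfolding X_def by (rule derives_mono_length)
qed

section \<open>Column sums from the hole axioms\<close>

text \<open>The hole axioms between pigeon \<open>t + 1\<close> and the pigeons \<open>1..t\<close>
  share one literal. It serves as common side formula while the other literals, read as sums of
  value 0, are added up.\<close>

lemma derivable_column_zero:
  assumes k: "k \<in> {1..n}" and t: "1 \<le> t" "t < N"
  shows "derivable (t * (1 + w)) ({var_eq (Suc t, k) 0} \<union> sum_in ({1..t} \<times> {k}) {0..0})"
proof -
  have "derivable (t * (1 + w))
    ({var_eq (Suc t, k) 0} \<union> sum_in (\<Union>s\<in>{1..t}. {(s, k)}) {int t * 0..int t * 0})"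
  proof (rule derivable_sum_family)
    fix s assume s: "s \<in> {1..t}"
    let ?D = "{var_eq (s, k) 0, var_eq (Suc t, k) 0}"
    have "1 \<le> s \<and> s < Suc t \<and> Suc t \<le> m \<and> k \<in> {1..n}"
      using s k t n_less_m by (simp add: N_def)
    then have "?D \<in> neg_PHP m n" unfolding neg_PHP_def by blast
    then have "derivable 1 ?D"
      using s k t by (intro derives_single rlin_step.initial admissible_clause)
        (auto simp: clause_disj_def php_vars_def)
    then show "derivable 1 ({var_eq (Suc t, k) 0} \<union> sum_in {(s, k)} {0..0})"
      by (simp add: sum_in_single insert_commute)
  qed (use assms in \<open>auto simp: disjoint_family_on_def php_vars_def clause_disj_def\<close>)
  moreover have "(\<Union>s\<in>{1..t}. {(s, k)}) = {1..t} \<times> {k}" by auto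
  ultimately show ?thesis by simp
qed

text \<open>If \<open>x\<^sub>s\<^sub>k = 0\<close> for \<open>s = t + 1\<close>, the column sum does not change; otherwise the hole axioms make the
  sum of its first \<open>t\<close> entries 0.\<close>

lemma derivable_column_prefix:
  assumes k: "k \<in> {1..n}" and "1 \<le> t" "t \<le> N"
  shows "derivable (t * r) (sum_in ({1..t} \<times> {k}) {0..1})"
  using assms(2,3)
proof (induction t rule: nat_induct_at_least)
  case base
  have "(1::nat, k) \<in> php_vars N n" using k by (auto simp: php_vars_def N_def)
  then have "derivable (1 * r) (sum_in {(1::nat, k)} {0..1})"
    by (rule derives_mono_length[OF derivable_boolean]) (simp add: r_def)
  then show ?case by simp
next
  case (Suc t)
  let ?S = "\<lambda>t. {1..t} \<times> {k}" and ?v = "(Suc t, k)"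
  have v: "?v \<in> php_vars N n" and S: "?S t \<subseteq> php_vars N n" "?S (Suc t) \<subseteq> php_vars N n"
    and S_Suc: "?S t \<union> {?v} = ?S (Suc t)" "{?v} \<union> ?S t = ?S (Suc t)" "?S t \<inter> {?v} = {}"
    "{?v} \<inter> ?S t = {}"
    using k Suc.prems by (auto simp: php_vars_def)
  have M: "1 \<le> int (N * n)"
    using le_trans[OF n_pos N_bounds(3)] by (simp del: of_nat_mult)
  have IH: "derivable (t * r) ({} \<union> sum_in (?S t) {0..1})"
    using Suc.IH Suc.prems by simp
  have \<Gamma>: "sum_in (?S (Suc t)) {0..1} \<subseteq> clause_disj (php_vars N n) (php_vars N n) \<union>
      sum_in (?S (Suc t)) {- int (N * n)..int (N * n)}"
    using M by (intro le_supI2 sum_in_mono) auto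
  have zero: "derivable (t * (1 + w)) ({var_eq ?v 0} \<union> sum_in (?S t) {0..0})"
    using Suc.hyps Suc.prems k by (intro derivable_column_zero) auto
  have bool: "derivable 1 ({} \<union> sum_in {?v} {0..1})" using derivable_boolean[OF v] by simp
  have "derivable (t * (1 + w) + 1 + w)
    ({var_eq ?v 0} \<union> sum_in (?S t \<union> {?v}) {0 + 0..0 + 1})"
    by (rule derivable_add[OF zero bool S_Suc(3) S(1), where Z = "{}"])
       (use v M in \<open>auto simp: clause_disj_def\<close>)
  \<comment> \<open>The literal from the side formula is now read as a sum of value 0 and becomes
    the operand to add to the induction hypothesis. That addition gives the range
    \<open>{0..1}\<close> again, so its result merges with the side formula.\<close>
  then have step: "derivable (t * (1 + w) + 1 + w)
    (sum_in (?S (Suc t)) {0..1} \<union> sum_in {?v} {0..0})"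
    unfolding S_Suc by (simp add: sum_in_single)
  have "derivable (t * (1 + w) + 1 + w + t * r + w)
    (sum_in (?S (Suc t)) {0..1} \<union> sum_in ({?v} \<union> ?S t) {0 + 0..0 + 1})"
    by (rule derivable_add[OF step IH S_Suc(4) _ S(1) _ \<Gamma> S(2)]) (use v M in auto)
  then have "derivable (t * (1 + w) + 1 + w + t * r + w) (sum_in (?S (Suc t)) {0..1})"
    unfolding S_Suc by simp
  moreover have "t * (1 + w) + 1 + w + t * r + w \<le> Suc t * r"
  proof -
    have "t * (1 + w) \<le> N * (1 + w)" using Suc.prems by (intro mult_le_mono1) simp
    then show ?thesis by (simp add: r_def)
  qed
  ultimately show ?case by (rule derives_mono_length)
qed

section \<open>Sums over all variables and the refutation\<close>

lemma derivable_rows_total: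
  "derivable (N * (n * r + w)) (sum_in (php_vars N n) {int N..int (N * n)})"
proof -
  have "derivable (N * (n * r + w))
    ({} \<union> sum_in (\<Union>i\<in>{1..N}. {i} \<times> {1..n}) {int N * 1..int N * int n})"
  proof (rule derivable_sum_family)
    \<comment> \<open>At \<open>t = n\<close> no literals are left in the row prefix, so the side
      formula is empty.\<close>
    show "derivable (n * r) ({} \<union> sum_in ({i} \<times> {1..n}) {1..int n})" if "i \<in> {1..N}" for i
      using derivable_row_prefix[OF that n_pos] by simp
  qed (use n_pos N_bounds in \<open>auto simp: disjoint_family_on_def php_vars_def\<close>)
  moreover have "(\<Union>i\<in>{1..N}. {i} \<times> {1..n}) = php_vars N n" by (auto simp: php_vars_def)
  ultimately show ?thesis by simp
qed

lemma derivable_columns_total: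
  "derivable (n * (N * r + w)) (sum_in (php_vars N n) {0..int n})"
proof -
  have "derivable (n * (N * r + w))
    ({} \<union> sum_in (\<Union>k\<in>{1..n}. {1..N} \<times> {k}) {int n * 0..int n * 1})"
  proof (rule derivable_sum_family)
    show "derivable (N * r) ({} \<union> sum_in ({1..N} \<times> {k}) {0..1})" if "k \<in> {1..n}" for k
      using derivable_column_prefix[OF that, of N] by (simp add: N_def)
    show "int n * 1 \<le> int (N * n)" using N_bounds(3) by (simp del: of_nat_mult)
  qed (use n_pos in \<open>auto simp: disjoint_family_on_def php_vars_def\<close>)
  moreover have "(\<Union>k\<in>{1..n}. {1..N} \<times> {k}) = php_vars N n" by (auto simp: php_vars_def)
  ultimately show ?thesis by simp
qed

lemma R0lin_refutation_exists:
  "\<exists>\<pi>. R0lin_refutation 1 5 (php_vars m n) (neg_PHP m n) \<pi> \<and>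
     proof_size \<pi> \<le> (n * (N * r + w) + N * (n * r + w) + 2 * w) * (20 * (N * n + 1) ^ 2)"
proof -
  let ?V = "php_vars N n" and ?M = "N * n" and ?n = "n * (N * r + w) + N * (n * r + w) + 2 * w"
  have V: "finite ?V" "card ?V \<le> ?M + 1" "?V \<subseteq> php_vars m n"
    using n_less_m by (auto simp: php_vars_def card_cartesian_product N_def)
  \<comment> \<open>The parameter \<open>s\<close> becomes \<open>N * n + 1\<close>, which exceeds
    both the number of variables and the value bound.\<close>
  note size = admissible_size[OF V(1,2), where M = ?M]
  have over: "lindisj_over (php_vars m n) D" if "admissible ?V ?M D" for D
    using size(1)[OF _ that] V(3) by (auto simp: lindisj_over_def)
  have contradiction: "derivable ?n {}"
    by (rule derivable_contradiction[OF derivable_columns_total derivable_rows_total])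
       (use N_bounds in \<open>simp_all del: of_nat_mult\<close>)
  then obtain \<pi> where \<pi>: "rlin_refutation (php_vars m n) (neg_PHP m n) \<pi>"
    "\<forall>D\<in>set \<pi>. admissible ?V ?M D" "length \<pi> \<le> ?n"
    using derives_refutation[OF contradiction over] by blast
  have "proof_size \<pi> \<le> (\<Sum>D\<leftarrow>\<pi>. 20 * (?M + 1) ^ 2)"
    unfolding proof_size_def using \<pi>(2) size(2) by (intro sum_list_mono) auto
  also have "\<dots> \<le> ?n * (20 * (?M + 1) ^ 2)"
    using \<pi>(3) by (simp add: sum_list_triv mult_le_mono1 del: power_Suc)
  finally have "proof_size \<pi> \<le> ?n * (20 * (?M + 1) ^ 2)" .
  moreover have "R0lin_refutation 1 5 (php_vars m n) (neg_PHP m n) \<pi>"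
    using \<pi>(1,2) admissible_R0lin_line[OF V(1)] by (auto simp: R0lin_refutation_def)
  ultimately show ?thesis by blast
qed

end

theorem theorem6p4:
  "\<exists>(c::nat) (d::nat) (p::nat poly). \<forall>(m::nat) (n::nat). m > n \<longrightarrow>
     (\<exists>\<pi>. R0lin_refutation c d (php_vars m n) (neg_PHP m n) \<pi> \<and> proof_size \<pi> \<le> poly p n)"
proof -
  \<comment> \<open>These polynomials mirror \<open>n\<close>, \<open>N\<close>, \<open>w\<close>,
    \<open>r\<close> and the final size bound as functions of \<open>n\<close>.\<close>
  define pn :: "nat poly" where "pn = [:0, 1:]"
  define pN where "pN = pn + 1"
  define pw where "pw = (2 * (pN * pn) + 1) ^ 2"
  define pr where "pr = pN * (1 + pw) + 1 + 2 * pw"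
  define p where
    "p = (pn * (pN * pr + pw) + pN * (pn * pr + pw) + 2 * pw) * (20 * (pN * pn + 1) ^ 2)"
  have "\<exists>\<pi>. R0lin_refutation 1 5 (php_vars m n) (neg_PHP m n) \<pi> \<and> proof_size \<pi> \<le> poly p n"
    if "n < m" for m n
  proof (cases "n = 0")
    case True
    \<comment> \<open>Without holes the axiom of any pigeon is already the empty disjunction, and
      there is a pigeon since \<open>m > 0\<close>.\<close>
    have "{} \<in> neg_PHP m n" using True that by (auto simp: neg_PHP_def)
    then have "R0lin_refutation 1 5 (php_vars m n) (neg_PHP m n) [{}]"
      by (auto simp: R0lin_refutation_def rlin_refutation_def rlin_proof_def lindisj_over_def
          R0lin_line_def partition_on_empty intro: rlin_step.initial)
    then show ?thesis by (intro exI[of _ "[{}]"]) (simp add: proof_size_def disj_size_def)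
  next
    case False
    interpret pigeonhole m n by unfold_locales (use that False in auto)
    have pn: "poly pn n = n" by (simp add: pn_def)
    have pN: "poly pN n = N" by (simp add: pN_def pn N_def)
    have pw: "poly pw n = w" by (simp add: pw_def pN pn w_def)
    have pr: "poly pr n = r" by (simp add: pr_def pN pw r_def)
    have "poly p n = (n * (N * r + w) + N * (n * r + w) + 2 * w) * (20 * (N * n + 1) ^ 2)"
      by (simp add: p_def pn pN pw pr)
    then show ?thesis using R0lin_refutation_exists by simp
  qed
  then show ?thesis by blast
qed

end
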